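(* For every real $R$ with $1<R\le 3/2$ and every $\epsilon>0$, the competitive ratio of the proportional\&non-removable online knapsack problem with a buffer of capacity $R$ is at least $\frac{1}{R-1}-\epsilon$; i.e., for every deterministic online algorithm $\mathrm{ALG}$ there is an input $I$ with $\mathrm{OPT}(I)\ge(\frac{1}{R-1}-\epsilon)\mathrm{ALG}(I)$ (with $\mathrm{OPT}(I)>0=\mathrm{ALG}(I)$ counting as infinite ratio).
   Context: Online knapsack problem with a resource buffer: there is a knapsack of capacity $1$ and a buffer of capacity $R\ge 1$. Items $e_1,\dots,e_n$ arrive one by one; each item $e$ has size $0<s(e)\le 1$ and value $v(e)\ge 0$; $s(B),v(B)$ denote sums over a set $B$. A deterministic online algorithm maintains buffer contents $B_0=\emptyset,B_1,\dots,B_n$, with $B_i$ chosen after seeing only $e_1,\dots,e_i$, $B_i\subseteq B_{i-1}\cup\{e_i\}$, $s(B_i)\le R$; in the non-removable setting additionally $B_{i-1}\subseteq B_i$. $\mathrm{ALG}(I)=\max\{v(B)\mid B\subseteq B_n,\ s(B)\le 1\}$, $\mathrm{OPT}(I)=\max\{v(B)\mid B\subseteq\{e_1,\dots,e_n\},\ s(B)\le 1\}$. "Proportional" means $v(e)=s(e)$ for every item. The competitive ratio of an algorithm is $\sup_I \mathrm{OPT}(I)/\mathrm{ALG}(I)$ (with $a/0=\infty$ for $a>0$), and the competitive ratio of the problem is the infimum of this over all deterministic online algorithms. *)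

theory Defs
  imports Complex_Main "HOL-Library.Extended_Real"
begin

text \<open>
  An input is the list of items in order of arrival. Items are identified by their position in this
  list, so that several items may have the same size and value; sets of items are sets of positions.
\<close>

record item =
  item_size :: real
  item_value :: real

definition valid_input :: "item list \<Rightarrow> bool" where
  "valid_input I \<longleftrightarrow> (\<forall>e\<in>set I. 0 < item_size e \<and> item_size e \<le> 1 \<and> 0 \<le> item_value e)"

definition proportional :: "item list \<Rightarrow> bool" where
  "proportional I \<longleftrightarrow> (\<forall>e\<in>set I. item_value e = item_size e)"

definition proportional_inputs :: "item list set" where
  "proportional_inputs = {I. valid_input I \<and> proportional I}"

definition total_size :: "item list \<Rightarrow> nat set \<Rightarrow> real" where
  "total_size I B = (\<Sum>i\<in>B. item_size (I ! i))"

definition total_value :: "item list \<Rightarrow> nat set \<Rightarrow> real" where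
  "total_value I B = (\<Sum>i\<in>B. item_value (I ! i))"

text \<open>
  A deterministic online algorithm is a function \<open>A\<close> from item lists to buffer contents: on the
  input \<open>e\<^sub>1, \<dots>, e\<^sub>n\<close>, the buffer \<open>B\<^sub>i\<close> is \<open>A [e\<^sub>1, \<dots>, e\<^sub>i]\<close>, so it depends on the items seen so far
  only (neither on later items nor on \<open>n\<close>). The conditions are imposed only on the inputs \<open>\<I>\<close> of
  the problem at hand, a prefix-closed set. The item arriving after \<open>I\<close> has position \<open>length I\<close>.
\<close>

type_synonym algorithm = "item list \<Rightarrow> nat set"

definition online_algorithm :: "real \<Rightarrow> item list set \<Rightarrow> algorithm \<Rightarrow> bool" where
  "online_algorithm R \<I> A \<longleftrightarrow>
     A [] = {} \<and>
     (\<forall>I e. I @ [e] \<in> \<I> \<longrightarrow> A (I @ [e]) \<subseteq> A I \<union> {length I}) \<and>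
     (\<forall>I\<in>\<I>. total_size I (A I) \<le> R)"

definition non_removable :: "item list set \<Rightarrow> algorithm \<Rightarrow> bool" where
  "non_removable \<I> A \<longleftrightarrow> (\<forall>I e. I @ [e] \<in> \<I> \<longrightarrow> A I \<subseteq> A (I @ [e]))"

definition best_packing :: "item list \<Rightarrow> nat set \<Rightarrow> real" where
  "best_packing I S = Max {total_value I B |B. B \<subseteq> S \<and> total_size I B \<le> 1}"

definition ALG :: "algorithm \<Rightarrow> item list \<Rightarrow> real" where
  "ALG A I = best_packing I (A I)"

definition OPT :: "item list \<Rightarrow> real" where
  "OPT I = best_packing I {..<length I}"

text \<open>
  Division on \<^typ>\<open>ereal\<close> satisfies \<open>a / 0 = \<infinity>\<close> for \<open>a > 0\<close>, and \<open>0 / 0 = 0\<close>. For proportional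
  inputs the latter case arises only for the empty input, which thus does not affect the supremum.
\<close>

definition algorithm_ratio :: "item list set \<Rightarrow> algorithm \<Rightarrow> ereal" where
  "algorithm_ratio \<I> A = (SUP I\<in>\<I>. ereal (OPT I) / ereal (ALG A I))"

definition competitive_ratio :: "item list set \<Rightarrow> algorithm set \<Rightarrow> ereal" where
  "competitive_ratio \<I> \<A> = (INF A\<in>\<A>. algorithm_ratio \<I> A)"

definition prop_nonremovable_algorithms :: "real \<Rightarrow> algorithm set" where
  "prop_nonremovable_algorithms R =
     {A. online_algorithm R proportional_inputs A \<and> non_removable proportional_inputs A}"

end

theory Submission imports Defs begin

text \<open>
  The adversary offers an item of size \<open>R - 1 + \<delta>\<close> and, if it is accepted, one of size \<open>1\<close>.
  Rejecting the first item leaves the algorithm with value \<open>0\<close>; after accepting it, the second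
  item no longer fits into the buffer.
\<close>

text \<open>\<open>Max\<close> is only meaningful on finite nonempty sets, so every bound on
  \<open>best_packing\<close> rests on this.\<close>

lemma finite_packings:
  assumes "finite S"
  shows "finite {total_value I B |B. B \<subseteq> S \<and> total_size I B \<le> 1}"
  by (rule finite_subset[of _ "total_value I ` Pow S"]) (use assms in auto)

lemma best_packing_ge:
  assumes "finite S" "B \<subseteq> S" "total_size I B \<le> 1"
  shows "total_value I B \<le> best_packing I S"
  unfolding best_packing_def
  by (rule Max_ge) (use assms finite_packings in auto)

text \<open>With nonnegative values no subset beats all of \<open>S\<close>. This evaluates
  \<open>ALG\<close> exactly on a buffer that fits into the knapsack as a whole.\<close>

lemma best_packing_eq_total_value:
  assumes "finite S" "total_size I S \<le> 1" "\<And>i. i \<in> S \<Longrightarrow> 0 \<le> item_value (I ! i)"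
  shows "best_packing I S = total_value I S"
  unfolding best_packing_def
proof (rule Max_eqI)
  fix y assume "y \<in> {total_value I B |B. B \<subseteq> S \<and> total_size I B \<le> 1}"
  then show "y \<le> total_value I S"
    using assms by (auto simp: total_value_def intro!: sum_mono2)
qed (use assms finite_packings in auto)

text \<open>Passes from the division-free form to the quotient. For \<open>q = 0\<close> the
  quotient is infinite because \<open>p\<close> is positive.\<close>

lemma le_ereal_ratio:
  assumes "0 < p" "0 \<le> q" "c * q \<le> p"
  shows "ereal c \<le> ereal p / ereal q"
  using assms by (cases "q = 0") (auto simp: field_simps)

text \<open>Here \<open>R < a + 1\<close> keeps the unit item from joining the first one in the
  buffer, and \<open>c * a \<le> 1\<close> says that the resulting ratio \<open>1 / a\<close> is at
  least \<open>c\<close>. The signs of \<open>OPT\<close> and \<open>ALG\<close> are recorded for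
  \<open>le_ereal_ratio\<close>.\<close>

lemma adversary_input:
  fixes R a c :: real
  assumes A: "A \<in> prop_nonremovable_algorithms R"
    and a: "0 < a" "a \<le> 1" "R < a + 1" "c * a \<le> 1"
  shows "\<exists>I\<in>proportional_inputs. 0 < OPT I \<and> 0 \<le> ALG A I \<and> c * ALG A I \<le> OPT I"
proof -
  define e f where "e = \<lparr>item_size = a, item_value = a\<rparr>"
    and "f = \<lparr>item_size = 1, item_value = 1\<rparr>"
  have I1: "[e] \<in> proportional_inputs" and I2: "[e, f] \<in> proportional_inputs"
    using a by (auto simp: proportional_inputs_def valid_input_def proportional_def e_def f_def)
  have empty: "A [] = {}"
    and step: "\<And>I g. I @ [g] \<in> proportional_inputs \<Longrightarrow> A (I @ [g]) \<subseteq> A I \<union> {length I}"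
    and keep: "\<And>I g. I @ [g] \<in> proportional_inputs \<Longrightarrow> A I \<subseteq> A (I @ [g])"
    and cap: "\<And>I. I \<in> proportional_inputs \<Longrightarrow> total_size I (A I) \<le> R"
    using A by (auto simp: prop_nonremovable_algorithms_def online_algorithm_def non_removable_def)
  have "A [e] \<subseteq> {0}"
    using step[of "[]" e] I1 empty by simp
  then consider "A [e] = {}" | "A [e] = {0}"
    by blast
  then show ?thesis
  proof cases
    case 1
    then have "ALG A [e] = 0"
      using best_packing_eq_total_value[of "{}" "[e]"]
      by (simp add: ALG_def total_size_def total_value_def)
    moreover have "a \<le> OPT [e]"
      using best_packing_ge[of "{..<1}" "{0}" "[e]"] a
      by (simp add: OPT_def total_size_def total_value_def e_def)
    \<comment> \<open>As \<open>ALG\<close> is 0, the required inequality reduces to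
      \<open>0 \<le> OPT [e]\<close>, whatever \<open>c\<close> is.\<close>
    ultimately show ?thesis
      using I1 a(1) by (intro bexI[of _ "[e]"]) auto
  next
    case 2
    have sub: "A [e, f] \<subseteq> {0, 1}" and sup: "0 \<in> A [e, f]"
      using step[of "[e]" f] keep[of "[e]" f] I2 2 by auto
    have "1 \<notin> A [e, f]"
    proof
      assume "1 \<in> A [e, f]"
      with sub sup have "A [e, f] = {0, 1}"
        by blast
      with cap[OF I2] a(3) show False
        by (simp add: total_size_def e_def f_def)
    qed
    with sub sup have "A [e, f] = {0}"
      by blast
    then have "ALG A [e, f] = a"
      using best_packing_eq_total_value[of "{0}" "[e, f]"] a
      by (simp add: ALG_def total_size_def total_value_def e_def)
    \<comment> \<open>The optimum may pack the unit item alone, at position 1.\<close>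
    moreover have "1 \<le> OPT [e, f]"
      using best_packing_ge[of "{..<2}" "{1}" "[e, f]"]
      by (simp add: OPT_def total_size_def total_value_def f_def numeral_2_eq_2)
    ultimately show ?thesis
      using I2 a by (intro bexI[of _ "[e, f]"]) auto
  qed
qed

theorem theorem2:
  fixes R \<epsilon> :: real
  assumes "1 < R" and "R \<le> 3 / 2" and "\<epsilon> > 0"
  shows "competitive_ratio proportional_inputs (prop_nonremovable_algorithms R)
           \<ge> ereal (1 / (R - 1) - \<epsilon>)
       \<and> (\<forall>A\<in>prop_nonremovable_algorithms R. \<exists>I\<in>proportional_inputs.
            OPT I > 0 \<and> OPT I \<ge> (1 / (R - 1) - \<epsilon>) * ALG A I)"
proof -
  define r where "r = R - 1"
  \<comment> \<open>The product \<open>(1 / r - \<epsilon>) * (r + \<delta>)\<close> exceeds 1 by at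
    most \<open>\<delta> / r - \<epsilon> * r\<close>, which is nonpositive once
    \<open>\<delta> \<le> \<epsilon> * r\<^sup>2\<close>. The cap \<open>1 / 2\<close>, together
    with \<open>r \<le> 1 / 2\<close>, makes \<open>r + \<delta>\<close> an admissible item
    size.\<close>
  define \<delta> where "\<delta> = min (\<epsilon> * r\<^sup>2) (1 / 2)"
  have r: "0 < r" "r \<le> 1 / 2"
    using assms by (auto simp: r_def)
  have \<delta>: "0 < \<delta>" "\<delta> \<le> 1 / 2" "\<delta> \<le> \<epsilon> * r\<^sup>2"
    using r assms(3) by (auto simp: \<delta>_def)
  have "\<delta> / r \<le> \<epsilon> * r"
    using \<delta>(3) r by (simp add: field_simps power2_eq_square)
  moreover have "0 \<le> \<epsilon> * \<delta>"
    using \<delta> assms(3) by simp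
  moreover have "(1 / r - \<epsilon>) * (r + \<delta>) = 1 + \<delta> / r - \<epsilon> * r - \<epsilon> * \<delta>"
    using r by (simp add: field_simps)
  ultimately have "(1 / r - \<epsilon>) * (r + \<delta>) \<le> 1"
    by linarith
  then have adversary: "\<exists>I\<in>proportional_inputs.
      0 < OPT I \<and> 0 \<le> ALG A I \<and> (1 / (R - 1) - \<epsilon>) * ALG A I \<le> OPT I"
    if "A \<in> prop_nonremovable_algorithms R" for A
    using that r \<delta> by (intro adversary_input[where a = "r + \<delta>"]) (auto simp: r_def)
  \<comment> \<open>The supremum dominates the ratio on the adversary's input, which may depend on
    \<open>A\<close>; the infimum over \<open>A\<close> then inherits the bound.\<close>
  have "ereal (1 / (R - 1) - \<epsilon>) \<le> algorithm_ratio proportional_inputs A"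
    if "A \<in> prop_nonremovable_algorithms R" for A
    using adversary[OF that] unfolding algorithm_ratio_def
    by (blast intro: SUP_upper2 le_ereal_ratio)
  then show ?thesis
    using adversary unfolding competitive_ratio_def by (blast intro: INF_greatest)
qed

end
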